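(* Let $\mathbb{K}$ be $\mathbb{R}$ or $\mathbb{C}$. There is a bijective continuous map $\Psi:\beta\mathbb{K}\setminus Q(\mathbb{K})\to\theta\mathbb{K}$.
   Context: $\mathbb{K}$ carries its usual topology and $\beta\mathbb{K}$ is its Stone-Čech compactification. $Q(\mathbb{K})$ is the set of far points of $\beta\mathbb{K}$: those $p\in\beta\mathbb{K}$ not in the $\beta\mathbb{K}$-closure of any closed discrete subset of $\mathbb{K}$ (equivalently, the $z$-ultrafilter on $\mathbb{K}$ corresponding to $p$ contains no closed discrete subset of $\mathbb{K}$). $\beta\mathbb{K}\setminus Q(\mathbb{K})$ has the subspace topology. $\mathcal{D}(\mathbb{K})$ is the collection of all closed discrete subsets of $\mathbb{K}$ together with the special member $\mathbb{K}$ itself. A discrete $z$-filter on $\mathbb{K}$ is a collection $\mathcal{F}$ of members of $\mathcal{D}(\mathbb{K})$ such that $\emptyset\notin\mathcal{F}$; $D_1,D_2\in\mathcal{F}$ implies $D_1\cap D_2\in\mathcal{F}$; and $D_1\in\mathcal{F}$, $D\in\mathcal{D}(\mathbb{K})$, $D_1\subseteq D$ imply $D\in\mathcal{F}$. A discrete $z$-ultrafilter is a discrete $z$-filter that is maximal under inclusion. $\theta\mathbb{K}$ is the set of all discrete $z$-ultrafilters on $\mathbb{K}$, regarded as an index set: $\mathcal{D}^p$ is the discrete $z$-ultrafilter corresponding to the point $p\in\theta\mathbb{K}$. It is topologized by taking as basic closed sets the sets $\overline{Z}=\{p\in\theta\mathbb{K}: Z\in\mathcal{D}^p\}$, for $Z$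 a closed discrete subset of $\mathbb{K}$. *)

theory Defs
  imports "HOL-Analysis.Analysis"
begin

section \<open>The Stone--Cech compactification\<close>

text \<open>Tychonoff's construction: the closure of the image of the evaluation map in the cube
  indexed by all continuous functions into the unit interval. In a product topology points are
  extensional functions, hence the \<open>restrict\<close> in the evaluation map.\<close>

definition unit_funs :: "('a::topological_space \<Rightarrow> real) set" where
  "unit_funs = {f. continuous_on UNIV f \<and> range f \<subseteq> {0..1}}"

definition unit_cube :: "(('a::topological_space \<Rightarrow> real) \<Rightarrow> real) topology" where
  "unit_cube = product_topology (\<lambda>f. top_of_set {0..1}) unit_funs"

definition sc_embed :: "'a::topological_space \<Rightarrow> ('a \<Rightarrow> real) \<Rightarrow> real" where
  "sc_embed x = restrict (\<lambda>f. f x) unit_funs"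

definition stone_cech :: "(('a::topological_space \<Rightarrow> real) \<Rightarrow> real) topology" where
  "stone_cech = subtopology unit_cube (unit_cube closure_of range sc_embed)"

definition far_points :: "(('a::topological_space \<Rightarrow> real) \<Rightarrow> real) set" where
  "far_points = {p \<in> topspace stone_cech.
     \<forall>D. closed D \<and> discrete D \<longrightarrow> p \<notin> stone_cech closure_of (sc_embed ` D)}"

section \<open>Discrete z-ultrafilters\<close>

definition discrete_family :: "'a::topological_space set set" where
  "discrete_family = insert UNIV {D. closed D \<and> discrete D}"

definition discrete_zfilter :: "'a::topological_space set set \<Rightarrow> bool" where
  "discrete_zfilter F \<longleftrightarrow>
     F \<subseteq> discrete_family \<and> {} \<notin> F \<and>
     (\<forall>D1\<in>F. \<forall>D2\<in>F. D1 \<inter> D2 \<in> F) \<and>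
     (\<forall>D1\<in>F. \<forall>D\<in>discrete_family. D1 \<subseteq> D \<longrightarrow> D \<in> F)"

definition discrete_zultrafilter :: "'a::topological_space set set \<Rightarrow> bool" where
  "discrete_zultrafilter F \<longleftrightarrow>
     discrete_zfilter F \<and> (\<forall>G. discrete_zfilter G \<and> F \<subseteq> G \<longrightarrow> G = F)"

text \<open>The index \<open>p\<close> is identified with the ultrafilter \<open>D\<^sup>p\<close> that it names.\<close>

definition theta_points :: "'a::topological_space set set set" where
  "theta_points = {p. discrete_zultrafilter p}"

definition theta_basic :: "'a::topological_space set \<Rightarrow> 'a set set set" where
  "theta_basic Z = {p \<in> theta_points. Z \<in> p}"

text \<open>The library generates topologies from a subbase; lemma \<open>closedin_theta_iff\<close> shows that
  the basic closed sets do form a base for the closed sets of the resulting topology.\<close>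

definition theta :: "'a::topological_space set set topology" where
  "theta = topology_generated_by
     {theta_points - theta_basic Z | Z. closed Z \<and> discrete Z}"

section \<open>Basic properties\<close>

lemma topspace_unit_cube: "topspace unit_cube = (\<Pi>\<^sub>E f\<in>unit_funs. {0..1})"
  by (simp add: unit_cube_def)

lemma sc_embed_in_cube: "range sc_embed \<subseteq> topspace unit_cube"
  unfolding topspace_unit_cube sc_embed_def[abs_def] image_subset_iff restrict_PiE_iff
  by (auto simp: unit_funs_def image_subset_iff)

lemma compact_space_stone_cech: "compact_space stone_cech"
  unfolding stone_cech_def
  by (rule compact_space_subtopology, rule closedin_compact_space)
     (auto simp: unit_cube_def compact_space_product_topology compact_space_subtopology)

lemma Hausdorff_space_stone_cech: "Hausdorff_space stone_cech"
  unfolding stone_cech_def unit_cube_def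
  by (intro Hausdorff_space_subtopology)
     (simp add: Hausdorff_space_product_topology Hausdorff_space_subtopology)

lemma sc_embed_in_stone_cech: "range sc_embed \<subseteq> topspace stone_cech"
  unfolding stone_cech_def
  using closure_of_subset[OF sc_embed_in_cube] sc_embed_in_cube by auto

lemma sc_embed_dense:
  "stone_cech closure_of (range (sc_embed :: 'a::topological_space \<Rightarrow> _)) = topspace stone_cech"
proof -
  let ?E = "range (sc_embed :: 'a \<Rightarrow> _)"
  have "?E \<subseteq> unit_cube closure_of ?E"
    by (rule closure_of_subset[OF sc_embed_in_cube])
  then have "(unit_cube closure_of ?E) \<inter> ?E = ?E"
    by (rule Int_absorb1)
  moreover have "topspace stone_cech = unit_cube closure_of ?E"
    by (simp add: stone_cech_def Int_absorb1 closure_of_subset_topspace)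
  ultimately show ?thesis
    by (simp add: stone_cech_def closure_of_subtopology)
qed

lemma embedding_map_sc_embed:
  "embedding_map (euclidean :: 'a::metric_space topology) stone_cech sc_embed"
proof -
  have eq: "mspace (submetric (cfunspace (euclidean :: 'a topology) euclidean_metric)
      {f. f \<in> topspace euclidean \<rightarrow> {0..1::real}}) = unit_funs"
  proof -
    have "Met_TC.mbounded (range f)" if "range f \<subseteq> {0..1::real}" for f :: "'a \<Rightarrow> real"
      using that bounded_subset[OF bounded_closed_interval] by simp
    then show ?thesis
      by (fastforce simp: unit_funs_def Pi_iff image_subset_iff)
  qed
  have "completely_regular_space (euclidean :: 'a topology)"
    by (simp add: metrizable_imp_completely_regular_space metrizable_space_euclidean)
  moreover have "Hausdorff_space (euclidean :: 'a topology)"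
    by simp
  ultimately have "embedding_map (euclidean :: 'a topology) unit_cube sc_embed"
    using completely_regular_space_cube_embedding_explicit[of "euclidean :: 'a topology"]
    unfolding eq unit_cube_def sc_embed_def[abs_def] by simp
  then show ?thesis
    unfolding stone_cech_def
    by (simp add: embedding_map_in_subtopology closure_of_subset[OF sc_embed_in_cube])
qed

lemma sc_embed_extension:
  assumes "f \<in> unit_funs"
  shows "continuous_map stone_cech (top_of_set {0..1}) (\<lambda>p. p f)" and "sc_embed x f = f x"
proof -
  show "continuous_map stone_cech (top_of_set {0..1}) (\<lambda>p. p f)"
    unfolding stone_cech_def unit_cube_def
    by (rule continuous_map_from_subtopology, rule continuous_map_product_projection, rule assms)
  show "sc_embed x f = f x"
    using assms by (simp add: sc_embed_def)
qed

lemma discrete_zfilterD: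
  assumes "discrete_zfilter F"
  shows "{} \<notin> F" and "\<lbrakk>X \<in> F; Y \<in> F\<rbrakk> \<Longrightarrow> X \<inter> Y \<in> F"
    and "\<lbrakk>X \<in> F; Y \<in> discrete_family; X \<subseteq> Y\<rbrakk> \<Longrightarrow> Y \<in> F"
proof -
  note * = assms[unfolded discrete_zfilter_def]
  show "{} \<notin> F" by (rule *[THEN conjunct2, THEN conjunct1])
  show "X \<inter> Y \<in> F" if "X \<in> F" "Y \<in> F"
    by (rule *[THEN conjunct2, THEN conjunct2, THEN conjunct1, THEN bspec, THEN bspec]) (fact that)+
  show "Y \<in> F" if "X \<in> F" "Y \<in> discrete_family" "X \<subseteq> Y"
    by (rule *[THEN conjunct2, THEN conjunct2, THEN conjunct2, THEN bspec, THEN bspec, THEN mp])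
      (fact that)+
qed

lemma discrete_zultrafilter_disjoint:
  assumes U: "discrete_zultrafilter F" and Z: "closed Z" "discrete Z" "Z \<notin> F"
  shows "\<exists>A\<in>F. Z \<inter> A = {}"
proof (rule ccontr)
  assume contra: "\<not> ?thesis"
  have F: "discrete_zfilter F"
    using U by (simp add: discrete_zultrafilter_def)
  have I: "A \<inter> B \<in> F" if "A \<in> F" "B \<in> F" for A B
    using F that unfolding discrete_zfilter_def by blast
  define F' where "F' = insert UNIV F"
  define G where "G = {D \<in> discrete_family. \<exists>A\<in>F'. Z \<inter> A \<subseteq> D}"
  have I': "A \<inter> B \<in> F'" if "A \<in> F'" "B \<in> F'" for A B
    using that I by (auto simp: F'_def)
  have meet: "Z \<inter> A \<noteq> {}" if "A \<in> F'" for A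
  proof (cases "A \<in> F")
    case False
    then have "A = UNIV" using that by (simp add: F'_def)
    moreover have "Z \<noteq> {}"
    proof
      assume Ze: "Z = {}"
      then have "F = {}" using contra by auto
      moreover have "discrete_zfilter {UNIV}"
        by (auto simp: discrete_zfilter_def discrete_family_def)
      ultimately show False
        using U unfolding discrete_zultrafilter_def by blast
    qed
    ultimately show ?thesis by simp
  qed (use contra in auto)
  have int: "D1 \<inter> D2 \<in> discrete_family"
    if "D1 \<in> discrete_family" "D2 \<in> discrete_family" for D1 D2 :: "'a set"
    using that by (auto simp: discrete_family_def intro: discrete_subset)
  have "discrete_zfilter G"
    unfolding discrete_zfilter_def
  proof (intro conjI ballI impI)
    show "G \<subseteq> discrete_family" by (auto simp: G_def)
    show "{} \<notin> G" using meet by (auto simp: G_def)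
    show "D1 \<inter> D2 \<in> G" if "D1 \<in> G" "D2 \<in> G" for D1 D2
    proof -
      obtain A B where "A \<in> F'" "Z \<inter> A \<subseteq> D1" "B \<in> F'" "Z \<inter> B \<subseteq> D2"
        using \<open>D1 \<in> G\<close> \<open>D2 \<in> G\<close> unfolding G_def by auto
      moreover from this have "A \<inter> B \<in> F'" by (simp add: I')
      moreover have "D1 \<inter> D2 \<in> discrete_family"
        using that int by (simp add: G_def)
      ultimately show ?thesis unfolding G_def by blast
    qed
    show "D \<in> G" if "D1 \<in> G" "D \<in> discrete_family" "D1 \<subseteq> D" for D1 D
      using that unfolding G_def by blast
  qed
  moreover have "F \<subseteq> G"
    using F by (auto simp: G_def F'_def discrete_zfilter_def)
  ultimately have "G = F"
    using U unfolding discrete_zultrafilter_def by blast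
  moreover have "Z \<in> G"
    using Z by (auto simp: G_def F'_def discrete_family_def)
  ultimately show False
    using Z by simp
qed

lemma theta_basic_Un:
  fixes A B :: "'a::metric_space set"
  assumes "closed A" "discrete A" "closed B" "discrete B"
  shows "theta_basic (A \<union> B) = theta_basic A \<union> theta_basic B"
    and "closed (A \<union> B)" "discrete (A \<union> B)"
proof -
  show cl: "closed (A \<union> B)" using assms by (simp add: closed_Un)
  show di: "discrete (A \<union> B)"
  proof -
    have "\<not> x islimpt (A \<union> B)" if "x \<in> A \<union> B" for x
    proof -
      have *: "\<not> y islimpt S" if "closed S" "discrete S" for y :: 'a and S
      proof (cases "y \<in> S")
        case True
        then show ?thesis
          using discreteD[OF that(2) True] by (simp add: isolated_in_islimpt_iff)
      next
        case False
        then show ?thesis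
          using that(1) unfolding closed_limpt by blast
      qed
      show ?thesis using *[OF assms(1,2)] *[OF assms(3,4)] by (simp add: islimpt_Un)
    qed
    then show ?thesis by (simp add: discrete_def isolated_in_islimpt_iff)
  qed
  show "theta_basic (A \<union> B) = theta_basic A \<union> theta_basic B"
  proof (intro equalityI subsetI)
    fix p assume p: "p \<in> theta_basic (A \<union> B)"
    then have U: "discrete_zultrafilter p" "A \<union> B \<in> p"
      by (auto simp: theta_basic_def theta_points_def)
    then have F: "discrete_zfilter p" by (simp add: discrete_zultrafilter_def)
    have "A \<in> p \<or> B \<in> p"
    proof (rule ccontr)
      assume "\<not> ?thesis"
      then have n: "A \<notin> p" "B \<notin> p" by auto
      obtain S where S: "S \<in> p" "A \<inter> S = {}"
        using discrete_zultrafilter_disjoint[OF U(1) assms(1,2) n(1)] by (elim bexE)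
      obtain T where T: "T \<in> p" "B \<inter> T = {}"
        using discrete_zultrafilter_disjoint[OF U(1) assms(3,4) n(2)] by (elim bexE)
      have "(A \<union> B) \<inter> (S \<inter> T) \<in> p"
        by (intro discrete_zfilterD(2)[OF F] U(2) S(1) T(1))
      moreover have "(A \<union> B) \<inter> (S \<inter> T) = {}" using S(2) T(2) by blast
      ultimately show False using discrete_zfilterD(1)[OF F] by simp
    qed
    then show "p \<in> theta_basic A \<union> theta_basic B"
      using p by (auto simp: theta_basic_def)
  next
    fix p assume "p \<in> theta_basic A \<union> theta_basic B"
    then have p: "p \<in> theta_points" "A \<in> p \<or> B \<in> p"
      by (auto simp: theta_basic_def)
    then have F: "discrete_zfilter p"
      by (simp add: theta_points_def discrete_zultrafilter_def)
    have "A \<union> B \<in> discrete_family"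
      using cl di by (simp add: discrete_family_def)
    then have "A \<union> B \<in> p"
      using p(2) discrete_zfilterD(3)[OF F] by (meson Un_upper1 Un_upper2)
    then show "p \<in> theta_basic (A \<union> B)"
      using p(1) by (simp add: theta_basic_def)
  qed
qed

lemma theta_basic_empty: "theta_basic {} = {}"
  by (simp add: theta_basic_def theta_points_def discrete_zultrafilter_def discrete_zfilterD(1))

lemma topspace_theta: "topspace theta = theta_points"
proof -
  have "theta_points \<in> {theta_points - theta_basic Z | Z::'a set. closed Z \<and> discrete Z}"
    using theta_basic_empty discrete_empty by (metis (mono_tags, lifting) Diff_empty closed_empty mem_Collect_eq)
  then show ?thesis by (auto simp: theta_def)
qed

lemma closedin_theta_iff:
  "closedin theta C \<longleftrightarrow>
     (\<exists>\<Z>. (\<forall>Z\<in>\<Z>. closed Z \<and> discrete (Z :: 'a::metric_space set)) \<and>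
          C = theta_points \<inter> (\<Inter>Z\<in>\<Z>. theta_basic Z))" (is "_ \<longleftrightarrow> ?R C")
proof
  let ?S = "{theta_points - theta_basic Z | Z::'a set. closed Z \<and> discrete Z}"
  let ?cd = "\<lambda>\<Z>. \<forall>Z\<in>\<Z>. closed Z \<and> discrete (Z :: 'a set)"
  have gen: "\<exists>\<Z>. ?cd \<Z> \<and> U = (\<Union>Z\<in>\<Z>. theta_points - theta_basic Z)"
    if "generate_topology_on ?S U" for U
    using that
  proof induction
    case Empty
    show ?case by (rule exI[of _ "{}"]) simp
  next
    case (Int a b)
    then obtain X Y where X: "?cd X" "a = (\<Union>Z\<in>X. theta_points - theta_basic Z)"
      and Y: "?cd Y" "b = (\<Union>Z\<in>Y. theta_points - theta_basic Z)"
      by blast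
    let ?W = "{A \<union> B | A B. A \<in> X \<and> B \<in> Y}"
    have un: "theta_basic (A \<union> B) = theta_basic A \<union> theta_basic B \<and> closed (A \<union> B) \<and> discrete (A \<union> B)"
      if "A \<in> X" "B \<in> Y" for A B
      using that X(1) Y(1) theta_basic_Un[of A B] by simp
    have "?cd ?W" using un by auto
    moreover have "a \<inter> b = (\<Union>Z\<in>?W. theta_points - theta_basic Z)"
    proof (intro equalityI subsetI)
      fix p assume "p \<in> a \<inter> b"
      then obtain A B where AB: "A \<in> X" "B \<in> Y" "p \<in> theta_points"
        "p \<notin> theta_basic A" "p \<notin> theta_basic B"
        using X(2) Y(2) by blast
      then have "A \<union> B \<in> ?W" "p \<in> theta_points - theta_basic (A \<union> B)"
        using un[of A B] by auto
      then show "p \<in> (\<Union>Z\<in>?W. theta_points - theta_basic Z)" by blast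
    next
      fix p assume "p \<in> (\<Union>Z\<in>?W. theta_points - theta_basic Z)"
      then obtain A B where "A \<in> X" "B \<in> Y" "p \<in> theta_points" "p \<notin> theta_basic (A \<union> B)"
        by blast
      then show "p \<in> a \<inter> b" using un[of A B] X(2) Y(2) by blast
    qed
    ultimately show ?case by blast
  next
    case (UN K)
    then have "\<forall>k\<in>K. \<exists>\<Z>. ?cd \<Z> \<and> k = (\<Union>Z\<in>\<Z>. theta_points - theta_basic Z)"
      by blast
    then obtain f where f: "\<forall>k\<in>K. ?cd (f k) \<and> k = (\<Union>Z\<in>f k. theta_points - theta_basic Z)"
      unfolding bchoice_iff by blast
    have "?cd (\<Union>(f ` K))" using f by blast
    moreover have "\<Union>K = (\<Union>Z\<in>\<Union>(f ` K). theta_points - theta_basic Z)"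
    proof (intro equalityI subsetI)
      fix p assume "p \<in> \<Union>K"
      then obtain k where k: "k \<in> K" "p \<in> k" by (elim UnionE)
      then have "p \<in> (\<Union>Z\<in>f k. theta_points - theta_basic Z)"
        using bspec[OF f k(1), THEN conjunct2, THEN equalityD1] by (elim subsetD)
      then show "p \<in> (\<Union>Z\<in>\<Union>(f ` K). theta_points - theta_basic Z)"
        using k(1) by fast
    next
      fix p assume "p \<in> (\<Union>Z\<in>\<Union>(f ` K). theta_points - theta_basic Z)"
      then obtain k where k: "k \<in> K" "p \<in> (\<Union>Z\<in>f k. theta_points - theta_basic Z)"
        by fast
      then have "p \<in> k"
        using bspec[OF f k(1), THEN conjunct2, THEN equalityD2] by (elim subsetD)
      then show "p \<in> \<Union>K" using k(1) by (intro UnionI)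
    qed
    ultimately show ?case by (intro exI conjI)
  next
    case (Basis s)
    then obtain Z :: "'a set" where "closed Z" "discrete Z" "s = theta_points - theta_basic Z"
      by blast
    then show ?case by (intro exI[of _ "{Z}"]) simp
  qed
  assume "closedin theta C"
  then have C: "C \<subseteq> theta_points" "openin theta (theta_points - C)"
    by (auto simp: closedin_def topspace_theta)
  then obtain \<Z> where "?cd \<Z>" "theta_points - C = (\<Union>Z\<in>\<Z>. theta_points - theta_basic Z)"
    using gen[OF C(2)[unfolded theta_def openin_topology_generated_by_iff]] by (elim exE conjE)
  moreover from C(1) have "C = theta_points - (theta_points - C)"
    by (simp add: double_diff)
  ultimately have "?cd \<Z> \<and> C = theta_points \<inter> (\<Inter>Z\<in>\<Z>. theta_basic Z)"
    by auto
  then show "?R C" by (rule exI)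
next
  assume "?R C"
  then obtain \<Z> where cd: "\<forall>Z\<in>\<Z>. closed Z \<and> discrete (Z :: 'a set)"
    and C: "C = theta_points \<inter> (\<Inter>Z\<in>\<Z>. theta_basic Z)" by blast
  have "openin theta (theta_points - theta_basic Z)" if "Z \<in> \<Z>" for Z
    unfolding theta_def
    by (rule topology_generated_by_Basis, rule CollectI, intro exI[of _ Z] conjI refl)
      (use that cd in auto)
  then have "openin theta (\<Union>Z\<in>\<Z>. theta_points - theta_basic Z)"
    by (intro openin_Union) auto
  moreover have "theta_points - C = (\<Union>Z\<in>\<Z>. theta_points - theta_basic Z)"
    unfolding C by blast
  ultimately show "closedin theta C"
    by (simp add: closedin_def topspace_theta C)
qed

end

theory Submission
  imports Defs
begin

text \<open>The map sends \<open>p\<close> to its discrete trace: the members of the discrete family whose closure in the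
  compactification contains \<open>p\<close>. The argument is carried out for an arbitrary metric space.

  Everything rests on two facts about a closed discrete set \<open>E\<close>. All its subsets are again closed
  and discrete, so \<open>E\<close> can be cut along an arbitrary set into two closed pieces
  (\<open>closed_discrete_subset\<close>). And since a metric space is normal, disjoint closed sets have disjoint
  closures in the compactification (\<open>disjoint_closed_stone_cech_closures\<close>). Hence, if \<open>p\<close> lies in
  the closure of \<open>E\<close>, it lies in the closure of exactly one of the two pieces of any cut.

  Cutting one of two sets along the other shows that the trace is closed under intersection, for
  every \<open>p\<close>. A point that is not far has some closed discrete \<open>E\<close> in its trace, and then cutting \<open>E\<close>
  along a set \<open>D\<close> outside the trace gives a member of the trace disjoint from \<open>D\<close>; so the trace is
  maximal. Cutting \<open>E\<close> along a sublevel set of a continuous function that separates two points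
  shows that they have different traces. Conversely, by compactness the closures of the members of
  a discrete z-ultrafilter \<open>F\<close> have a common point \<open>p\<close>; its trace is a discrete z-filter containing
  \<open>F\<close>, hence equal to \<open>F\<close>. Finally, the preimage of the basic closed set of \<open>Z\<close> is the closure of
  \<open>Z\<close> intersected with the domain, which gives continuity.\<close>

section \<open>Closures of closed sets in the compactification\<close>

text \<open>A closed discrete set has no limit points at all, and neither does a subset of it.\<close>

lemma closed_discrete_subset:
  fixes D :: "'a::metric_space set"
  assumes "closed D" "discrete D" "E \<subseteq> D"
  shows "closed E" and "discrete E"
proof -
  show "discrete E" using assms(2,3) by (rule discrete_subset)
  have "\<not> x islimpt E" for x
  proof
    assume "x islimpt E"
    then have lim: "x islimpt D" using assms(3) islimpt_subset by blast
    with assms(1) have "x \<in> D" by (simp add: closed_limpt)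
    with assms(2) lim show False
      by (simp add: discrete_def isolated_in_islimpt_iff)
  qed
  then show "closed E" by (simp add: closed_limpt)
qed

text \<open>Evaluation at \<open>f\<close> is the continuous extension of \<open>f\<close> to the compactification, so bounds for \<open>f\<close>
  on \<open>A\<close> pass to the points adherent to \<open>A\<close>.\<close>

lemma stone_cech_closure_coordinate:
  assumes "f \<in> unit_funs" "closed S" "f ` A \<subseteq> S" "p \<in> stone_cech closure_of (sc_embed ` A)"
  shows "p f \<in> S"
proof -
  have "closedin (top_of_set {0..1}) ({0..1} \<inter> S)"
    using assms(2) by (simp add: closedin_closed_Int)
  then have "closedin stone_cech {q \<in> topspace stone_cech. q f \<in> {0..1} \<inter> S}"
    by (rule closedin_continuous_map_preimage[OF sc_embed_extension(1)[OF assms(1)]])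
  moreover have "f x \<in> {0..1}" for x
    using assms(1) unfolding unit_funs_def by blast
  then have "sc_embed ` A \<subseteq> {q \<in> topspace stone_cech. q f \<in> {0..1} \<inter> S}"
    using sc_embed_in_stone_cech sc_embed_extension(2)[OF assms(1)] assms(3) by auto
  ultimately have "stone_cech closure_of (sc_embed ` A)
      \<subseteq> {q \<in> topspace stone_cech. q f \<in> {0..1} \<inter> S}"
    by (intro closure_of_minimal)
  with assms(4) show ?thesis by auto
qed

text \<open>A Urysohn function that is 0 on \<open>A\<close> and 1 on \<open>B\<close> extends to the compactification, and its
  extension is still 0 on the closure of \<open>A\<close> and 1 on that of \<open>B\<close>.\<close>

lemma disjoint_closed_stone_cech_closures:
  fixes A B :: "'a::metric_space set"
  assumes "closed A" "closed B" "A \<inter> B = {}"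
  shows "stone_cech closure_of (sc_embed ` A) \<inter> stone_cech closure_of (sc_embed ` B) = {}"
proof -
  have "normal_space (euclidean :: 'a topology)"
    by (simp add: metrizable_imp_normal_space metrizable_space_euclidean)
  then obtain f where f: "continuous_map euclidean (top_of_set {0..1::real}) f"
    "f ` A \<subseteq> {0}" "f ` B \<subseteq> {1}"
    using assms Urysohn_lemma[of euclidean A B 0 1] by (auto simp: disjnt_def)
  then have "f \<in> unit_funs"
    by (auto simp: unit_funs_def continuous_map_in_subtopology)
  then show ?thesis
    using stone_cech_closure_coordinate[OF _ _ f(2)] stone_cech_closure_coordinate[OF _ _ f(3)]
    by fastforce
qed

lemma stone_cech_closure_split:
  assumes "p \<in> stone_cech closure_of (sc_embed ` D)"
  shows "p \<in> stone_cech closure_of (sc_embed ` (D \<inter> S)) \<or>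
         p \<in> stone_cech closure_of (sc_embed ` (D - S))"
proof -
  have "sc_embed ` D = sc_embed ` (D \<inter> S) \<union> sc_embed ` (D - S)" by blast
  with assms show ?thesis by (metis UnE closure_of_Un)
qed

text \<open>The piece \<open>D - E\<close> is closed and disjoint from \<open>E\<close>, so a point adherent to \<open>E\<close> is not adherent
  to it. The cut of \<open>D\<close> along \<open>E\<close> then leaves only the piece \<open>D \<inter> E\<close>.\<close>

lemma stone_cech_closure_Int:
  fixes D E :: "'a::metric_space set"
  assumes "closed D" "discrete D" "closed E"
    and "p \<in> stone_cech closure_of (sc_embed ` D)" "p \<in> stone_cech closure_of (sc_embed ` E)"
  shows "p \<in> stone_cech closure_of (sc_embed ` (D \<inter> E))"
proof -
  have "closed (D - E)"
    using closed_discrete_subset(1)[OF assms(1,2)] by blast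
  then have "p \<notin> stone_cech closure_of (sc_embed ` (D - E))"
    using disjoint_closed_stone_cech_closures[of "D - E" E] assms(3,5) by blast
  then show ?thesis
    using stone_cech_closure_split[OF assms(4)] by blast
qed

section \<open>Discrete traces are discrete z-ultrafilters\<close>

definition discrete_trace :: "(('a::metric_space \<Rightarrow> real) \<Rightarrow> real) \<Rightarrow> 'a set set" where
  "discrete_trace p = {D \<in> discrete_family. p \<in> stone_cech closure_of (sc_embed ` D)}"

lemma discrete_zfilter_trace:
  fixes p :: "('a::metric_space \<Rightarrow> real) \<Rightarrow> real"
  shows "discrete_zfilter (discrete_trace p)"
  unfolding discrete_zfilter_def
proof (intro conjI ballI impI)
  show "discrete_trace p \<subseteq> discrete_family" "{} \<notin> discrete_trace p" by (auto simp: discrete_trace_def)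
next
  fix D E assume D: "D \<in> discrete_trace p" and E: "E \<in> discrete_trace p"
  show "D \<inter> E \<in> discrete_trace p"
  proof (cases "D = UNIV \<or> E = UNIV")
    case False
    then have "closed D" "discrete D" "closed E"
      using D E by (auto simp: discrete_trace_def discrete_family_def)
    moreover from this have "closed (D \<inter> E)" "discrete (D \<inter> E)"
      using discrete_subset[of D] by auto
    ultimately show ?thesis
      using D E stone_cech_closure_Int[of D E p] by (simp add: discrete_trace_def discrete_family_def)
  qed (use D E in auto)
next
  fix D E assume "D \<in> discrete_trace p" "E \<in> discrete_family" "D \<subseteq> E"
  then show "E \<in> discrete_trace p"
    unfolding discrete_trace_def using closure_of_mono[of "sc_embed ` D" "sc_embed ` E" stone_cech] by blast
qed

text \<open>If a larger filter contained a set \<open>D\<close> outside the trace, it would also contain the piece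
  \<open>E - D\<close> of a closed discrete set \<open>E\<close> adherent to \<open>p\<close>, and these two are disjoint.\<close>

lemma trace_is_discrete_zultrafilter:
  fixes p :: "('a::metric_space \<Rightarrow> real) \<Rightarrow> real"
  assumes "p \<in> topspace stone_cech - far_points"
  shows "discrete_zultrafilter (discrete_trace p)"
  unfolding discrete_zultrafilter_def
proof (intro conjI allI impI discrete_zfilter_trace)
  fix G assume G: "discrete_zfilter G \<and> discrete_trace p \<subseteq> G"
  obtain E :: "'a set" where E: "closed E" "discrete E" "p \<in> stone_cech closure_of (sc_embed ` E)"
    using assms by (auto simp: far_points_def)
  have "D \<in> discrete_trace p" if "D \<in> G" for D
  proof (rule ccontr)
    assume D: "D \<notin> discrete_trace p"
    have "p \<notin> stone_cech closure_of (sc_embed ` (E \<inter> D))"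
      using D that G closure_of_mono[of "sc_embed ` (E \<inter> D)" "sc_embed ` D" stone_cech]
      by (auto simp: discrete_trace_def discrete_zfilter_def)
    then have "E - D \<in> discrete_trace p"
      using stone_cech_closure_split[OF E(3)] closed_discrete_subset[OF E(1,2), of "E - D"]
      by (auto simp: discrete_trace_def discrete_family_def)
    then have "D \<inter> (E - D) \<in> G"
      using G that discrete_zfilterD(2) by blast
    then show False
      using G discrete_zfilterD(1)[of G] by simp
  qed
  with G show "G = discrete_trace p" by blast
qed

section \<open>The trace map is a continuous bijection\<close>

text \<open>For \<open>c\<close> between the two values, the part of \<open>E\<close> where \<open>f \<le> c\<close> is adherent to \<open>p\<close> (the other
  part only to points where the extension of \<open>f\<close> is at least \<open>c\<close>) but not to \<open>q\<close>.\<close>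

lemma trace_separates:
  fixes p q :: "('a::metric_space \<Rightarrow> real) \<Rightarrow> real"
  assumes p: "p \<in> topspace stone_cech - far_points" and f: "f \<in> unit_funs" and "p f < q f"
  shows "\<not> discrete_trace p \<subseteq> discrete_trace q"
proof
  assume sub: "discrete_trace p \<subseteq> discrete_trace q"
  obtain c where c: "p f < c" "c < q f" using \<open>p f < q f\<close> dense by blast
  obtain E :: "'a set" where E: "closed E" "discrete E" "p \<in> stone_cech closure_of (sc_embed ` E)"
    using p by (auto simp: far_points_def)
  let ?L = "{x. f x \<le> c}"
  have "f ` (E - ?L) \<subseteq> {c..}" by auto
  then have "p \<notin> stone_cech closure_of (sc_embed ` (E - ?L))"
    using stone_cech_closure_coordinate[OF f, of "{c..}" "E - ?L" p] c by auto
  then have "E \<inter> ?L \<in> discrete_trace p"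
    using stone_cech_closure_split[OF E(3), of ?L] closed_discrete_subset[OF E(1,2), of "E \<inter> ?L"]
    by (auto simp: discrete_trace_def discrete_family_def)
  with sub have "q \<in> stone_cech closure_of (sc_embed ` (E \<inter> ?L))"
    by (auto simp: discrete_trace_def)
  moreover have "f ` (E \<inter> ?L) \<subseteq> {..c}" by auto
  ultimately show False
    using stone_cech_closure_coordinate[OF f, of "{..c}" "E \<inter> ?L" q] c by auto
qed

lemma inj_on_trace:
  "inj_on (discrete_trace :: (('a::metric_space \<Rightarrow> real) \<Rightarrow> real) \<Rightarrow> _) (topspace stone_cech - far_points)"
proof (rule inj_onI)
  fix p q :: "('a \<Rightarrow> real) \<Rightarrow> real"
  assume p: "p \<in> topspace stone_cech - far_points" and q: "q \<in> topspace stone_cech - far_points"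
    and eq: "discrete_trace p = discrete_trace q"
  have "p f = q f" if "f \<in> unit_funs" for f
    using trace_separates[OF p that, of q] trace_separates[OF q that, of p] eq
    by (metis linorder_neqE_linordered_idom order_refl)
  \<comment> \<open>Points of the cube are determined by their coordinates only because they are extensional.\<close>
  moreover have "p \<in> extensional unit_funs" "q \<in> extensional unit_funs"
    using p q by (auto simp: stone_cech_def topspace_unit_cube PiE_def)
  ultimately show "p = q" by (blast intro: extensionalityI)
qed

text \<open>A filter without a closed discrete member has at most the whole space as a member, so it
  lies in the filter of all members of the discrete family through an arbitrary point \<open>x\<close>. That
  filter is strictly larger, since it contains \<open>{x}\<close>. This is what keeps the limit point found in
  the next lemma from being a far point.\<close>

lemma discrete_zultrafilter_has_closed_discrete:
  assumes "discrete_zultrafilter (F :: 'a::metric_space set set)"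
  obtains D where "D \<in> F" "closed D" "discrete D"
proof (rule ccontr)
  assume contra: "\<not> thesis"
  have F: "discrete_zfilter F" and max: "\<And>G. discrete_zfilter G \<Longrightarrow> F \<subseteq> G \<Longrightarrow> G = F"
    using assms by (auto simp: discrete_zultrafilter_def)
  have F_UNIV: "F \<subseteq> {UNIV}"
    using F contra that by (auto simp: discrete_zfilter_def discrete_family_def)
  fix x :: 'a
  have sing: "discrete {x}"
    by (simp add: discrete_def isolated_in_islimpt_iff islimpt_finite)
  define G where "G = {D \<in> discrete_family. x \<in> D}"
  have "discrete_zfilter G"
    by (auto simp: discrete_zfilter_def discrete_family_def G_def intro: discrete_subset)
  moreover have "F \<subseteq> G"
    using F_UNIV by (auto simp: G_def discrete_family_def)
  ultimately have "G = F" by (rule max)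
  moreover have "{x} \<in> G" by (simp add: G_def discrete_family_def sing)
  ultimately show False using contra that[of "{x}"] sing by simp
qed

text \<open>Compactness supplies a point adherent to all members of \<open>F\<close>. Its trace is a discrete z-filter
  containing \<open>F\<close>, so the maximality of \<open>F\<close> gives equality.\<close>

lemma trace_surj:
  fixes F :: "'a::metric_space set set"
  assumes U: "discrete_zultrafilter F"
  obtains p where "p \<in> topspace stone_cech - far_points" "discrete_trace p = F"
proof -
  have F: "discrete_zfilter F" and max: "\<And>G. discrete_zfilter G \<Longrightarrow> F \<subseteq> G \<Longrightarrow> G = F"
    using U by (auto simp: discrete_zultrafilter_def)
  obtain E where E: "E \<in> F" "closed E" "discrete E"
    using discrete_zultrafilter_has_closed_discrete[OF U] .
  let ?cl = "\<lambda>D. stone_cech closure_of (sc_embed ` D)"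
  have fip: "\<Inter>\<G> \<noteq> {}" if \<G>: "finite \<G>" "\<G> \<subseteq> ?cl ` F" for \<G>
  proof -
    obtain H where H: "H \<subseteq> F" "finite H" "\<G> = ?cl ` H"
      using finite_subset_image[OF \<G>] by metis
    from H(2,1) have "\<exists>A\<in>F. A \<subseteq> \<Inter>H"
    proof (induction H)
      case (insert D H)
      then obtain A where "A \<in> F" "A \<subseteq> \<Inter>H" by auto
      then have "D \<inter> A \<in> F" "D \<inter> A \<subseteq> \<Inter>(insert D H)"
        using insert.prems discrete_zfilterD(2)[OF F] by auto
      then show ?case by blast
    qed (use E in auto)
    then obtain A where A: "A \<in> F" "A \<subseteq> \<Inter>H" by blast
    obtain x where "x \<in> A" using A(1) discrete_zfilterD(1)[OF F] by fastforce
    then have "sc_embed x \<in> ?cl D" if "D \<in> H" for D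
      using that A(2) sc_embed_in_stone_cech closure_of_subset_Int[of stone_cech "sc_embed ` D"]
      by blast
    then show ?thesis using H(3) by blast
  qed
  have "\<Inter>(?cl ` F) \<noteq> {}"
    by (rule compact_space_stone_cech[unfolded compact_space_fip, THEN spec, THEN mp])
       (intro conjI allI impI, simp, elim conjE, rule fip)
  then obtain p where p: "\<And>D. D \<in> F \<Longrightarrow> p \<in> ?cl D" by blast
  have "p \<in> topspace stone_cech - far_points"
    using p[OF E(1)] E(2,3) closure_of_subset_topspace by (fastforce simp: far_points_def)
  moreover have "F \<subseteq> discrete_trace p"
    using p F by (auto simp: discrete_trace_def discrete_zfilter_def)
  then have "discrete_trace p = F" by (rule max[OF discrete_zfilter_trace])
  ultimately show thesis by (rule that)
qed

lemma continuous_map_trace: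
  "continuous_map (subtopology stone_cech (topspace stone_cech - far_points)) theta
     (discrete_trace :: (('a::metric_space \<Rightarrow> real) \<Rightarrow> real) \<Rightarrow> _)"
  unfolding theta_def
proof (rule continuous_on_generated_topo)
  let ?N = "topspace stone_cech - far_points :: (('a \<Rightarrow> real) \<Rightarrow> real) set"
  let ?X = "subtopology stone_cech ?N"
  let ?S = "{theta_points - theta_basic Z | Z :: 'a set. closed Z \<and> discrete Z}"
  have N: "topspace ?X = ?N" by auto
  show "discrete_trace ` topspace ?X \<subseteq> \<Union>?S"
    using topspace_theta[where 'a='a] trace_is_discrete_zultrafilter[where 'a='a] unfolding N
    by (auto simp: theta_def theta_points_def)
  fix U assume "U \<in> ?S"
  then obtain Z :: "'a set" where Z: "U = theta_points - theta_basic Z" "closed Z" "discrete Z"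
    by blast
  have "discrete_trace -` U \<inter> topspace ?X = topspace ?X - stone_cech closure_of (sc_embed ` Z)"
    using trace_is_discrete_zultrafilter[where 'a='a] Z(2,3) unfolding N Z(1)
    by (auto simp: theta_basic_def theta_points_def discrete_trace_def discrete_family_def)
  also have "openin ?X \<dots>"
    unfolding N openin_subtopology
    by (intro exI[of _ "topspace stone_cech - stone_cech closure_of (sc_embed ` Z)"] conjI
        openin_diff openin_topspace closedin_closure_of) blast
  finally show "openin ?X (discrete_trace -` U \<inter> topspace ?X)" .
qed

lemma bij_betw_trace:
  "bij_betw (discrete_trace :: (('a::metric_space \<Rightarrow> real) \<Rightarrow> real) \<Rightarrow> _)
     (topspace stone_cech - far_points) (topspace theta)"
  unfolding bij_betw_def topspace_theta
proof (intro conjI inj_on_trace equalityI subsetI)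
  fix F :: "'a set set"
  { assume "F \<in> discrete_trace ` (topspace stone_cech - far_points)"
    then show "F \<in> theta_points"
      using trace_is_discrete_zultrafilter by (auto simp: theta_points_def) }
  { assume "F \<in> theta_points"
    then show "F \<in> discrete_trace ` (topspace stone_cech - far_points)"
      using trace_surj[of F] by (auto simp: theta_points_def) }
qed

theorem theorem3p9:
  shows
    "(\<exists>\<Psi> :: ((real \<Rightarrow> real) \<Rightarrow> real) \<Rightarrow> real set set.
        continuous_map
          (subtopology stone_cech (topspace stone_cech - far_points)) theta \<Psi> \<and>
        bij_betw \<Psi> (topspace stone_cech - far_points) (topspace theta)) \<and>
     (\<exists>\<Psi> :: ((complex \<Rightarrow> real) \<Rightarrow> real) \<Rightarrow> complex set set.
        continuous_map
          (subtopology stone_cech (topspace stone_cech - far_points)) theta \<Psi> \<and>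
        bij_betw \<Psi> (topspace stone_cech - far_points) (topspace theta))"
  by (rule conjI; rule exI[of _ discrete_trace]; rule conjI[OF continuous_map_trace bij_betw_trace])

end
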